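(* For every integer $n\geq 1$, the number $t_n$ of dependency trees with exactly $n$ nodes is $$t_n=\frac{1}{n}\binom{3n-2}{n-1}.$$
   Context: A dependency tree is defined recursively: it consists of a root node together with a finite (possibly empty) ordered sequence of dependency trees on the left of the root and a finite (possibly empty) ordered sequence of dependency trees on the right of the root (both sequences being empty gives the single-node tree). Equivalently, the class $\mathcal{T}$ of dependency trees satisfies $\mathcal{T}=\mathrm{SEQ}(\mathcal{T})\times\circ\times\mathrm{SEQ}(\mathcal{T})$, where $\circ$ is the root node (of size 1), $\times$ is the class of ordered pairs, and $\mathrm{SEQ}(\mathcal{A})$ is the class of finite sequences (including the empty one) of elements of $\mathcal{A}$. Nodes are unlabelled; two dependency trees are equal exactly when their left sequences coincide and their right sequences coincide. The size of a tree is its total number of nodes. *)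

theory Defs
  imports Complex_Main
begin

datatype deptree = Node (left_deps: "deptree list") (right_deps: "deptree list")

text \<open>The number of nodes of a tree. The size function generated by the datatype
  package also counts list constructors, so it is not used.\<close>

fun num_nodes :: "deptree \<Rightarrow> nat" where
  "num_nodes (Node ls rs) = 1 + sum_list (map num_nodes ls) + sum_list (map num_nodes rs)"

end

(* A tuple of m sequences of trees either starts with an empty sequence, which can be dropped, or
   its first sequence starts with a tree, whose root can be deleted, replacing that tree by its two
   sequences of subtrees. So the number W(m,n) of m-tuples with n nodes satisfies the linear
   recurrence W(m+1,n) = W(m,n) + W(m+3,n-1), which is solved by m/(3n+m) * binom(3n+m,n).
   A tree with n nodes is a root together with a pair of sequences with n-1 nodes. *)
theory Submission
  imports Defs
begin

definition forest_nodes :: "deptree list \<Rightarrow> nat" where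
  "forest_nodes ts = sum_list (map num_nodes ts)"

text \<open>The length \<open>m\<close> is kept general although trees only require
  \<open>m = 2\<close>: deleting a root replaces one sequence by three, so the recurrence leaves any
  fixed length.\<close>

definition forest_tuples :: "nat \<Rightarrow> nat \<Rightarrow> deptree list list set" where
  "forest_tuples m n = {fs. length fs = m \<and> sum_list (map forest_nodes fs) = n}"

lemma forest_nodes_simps [simp]:
  "forest_nodes [] = 0"
  "forest_nodes (t # ts) = num_nodes t + forest_nodes ts"
  by (simp_all add: forest_nodes_def)

lemma num_nodes_Node: "num_nodes (Node ls rs) = Suc (forest_nodes ls + forest_nodes rs)"
  by (simp add: forest_nodes_def)

text \<open>Inverse of the root deletion. It is applied only to lists of at least three sequences;
  the second equation is a default for shorter lists.\<close>

fun graft :: "deptree list list \<Rightarrow> deptree list list" where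
  "graft (ls # rs # ts # fs) = (Node ls rs # ts) # fs"
| "graft fs = fs"

lemma length_ge_3_conv:
  "length xs = m + 3 \<longleftrightarrow> (\<exists>a b c ys. xs = a # b # c # ys \<and> length ys = m)"
  by (auto simp: length_Suc_conv numeral_3_eq_3)

lemma forest_tuples_0: "forest_tuples 0 n = (if n = 0 then {[]} else {})"
  by (auto simp: forest_tuples_def)

lemma forest_tuples_Suc_0: "forest_tuples (Suc m) 0 = Cons [] ` forest_tuples m 0"
proof -
  have "forest_nodes f = 0 \<longleftrightarrow> f = []" for f
  proof (cases f)
    case (Cons t ts)
    then show ?thesis
      by (cases t) (simp add: num_nodes_Node del: num_nodes.simps)
  qed simp
  then show ?thesis
    by (auto simp: forest_tuples_def length_Suc_conv)
qed

lemma forest_tuples_Suc_Suc: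
  "forest_tuples (Suc m) (Suc n) =
     Cons [] ` forest_tuples m (Suc n) \<union> graft ` forest_tuples (m + 3) n"
proof (intro equalityI subsetI)
  fix fs assume fs: "fs \<in> forest_tuples (Suc m) (Suc n)"
  then obtain f gs where f: "fs = f # gs"
    by (auto simp: forest_tuples_def length_Suc_conv)
  show "fs \<in> Cons [] ` forest_tuples m (Suc n) \<union> graft ` forest_tuples (m + 3) n"
  proof (cases f)
    case Nil
    with fs f show ?thesis
      by (auto simp: forest_tuples_def)
  next
    case (Cons t ts)
    obtain ls rs where t: "t = Node ls rs"
      by (cases t)
    have "fs = graft (ls # rs # ts # gs)" "ls # rs # ts # gs \<in> forest_tuples (m + 3) n"
      using fs by (auto simp: forest_tuples_def f Cons t num_nodes_Node simp del: num_nodes.simps)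
    then show ?thesis
      by blast
  qed
qed (auto simp: forest_tuples_def length_ge_3_conv num_nodes_Node simp del: num_nodes.simps)

lemma inj_on_graft: "inj_on graft (forest_tuples (m + 3) n)"
  by (rule inj_on_inverseI[where g = "\<lambda>fs. left_deps (hd (hd fs)) # right_deps (hd (hd fs)) #
        tl (hd fs) # tl fs"])
    (auto simp: forest_tuples_def length_ge_3_conv)

text \<open>On tuples of length at least three, \<open>graft\<close> produces a nonempty first
  sequence.\<close>

lemma Cons_Nil_graft_disjoint:
  "Cons [] ` forest_tuples m k \<inter> graft ` forest_tuples (m + 3) n = {}"
  by (auto simp: forest_tuples_def length_ge_3_conv)

text \<open>The recurrence either lowers \<open>n\<close> while raising \<open>m\<close>, or keeps
  \<open>n\<close> and lowers \<open>m\<close>. Hence the outer induction on \<open>n\<close> for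
  all \<open>m\<close> and the inner one on \<open>m\<close>.\<close>

lemma finite_forest_tuples: "finite (forest_tuples m n)"
proof (induction n arbitrary: m)
  case 0
  show ?case
    by (induction m) (simp_all add: forest_tuples_0 forest_tuples_Suc_0)
next
  case (Suc n)
  then show ?case
    by (induction m) (simp_all add: forest_tuples_0 forest_tuples_Suc_Suc)
qed

lemma card_forest_tuples_Suc_Suc:
  "card (forest_tuples (Suc m) (Suc n)) =
     card (forest_tuples m (Suc n)) + card (forest_tuples (m + 3) n)"
  by (simp add: forest_tuples_Suc_Suc card_Un_disjoint finite_forest_tuples
      Cons_Nil_graft_disjoint card_image inj_on_graft)

lemma card_forest_tuples_0_right: "card (forest_tuples m 0) = 1"
  by (induction m) (simp_all add: forest_tuples_0 forest_tuples_Suc_0 card_image)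

text \<open>The closed form satisfies the recurrence, with \<open>a\<close> and \<open>b\<close>
  standing for the counts at \<open>(m, n + 1)\<close> and \<open>(m + 3, n)\<close>. Both involve
  the same upper index \<open>N\<close>, so everything reduces to the adjacent binomials
  \<open>P\<close> and \<open>Q\<close>.\<close>

lemma forest_recurrence_step:
  fixes a b :: real
  assumes a: "(3 * real (Suc n) + real m) * a = real m * real ((3 * Suc n + m) choose Suc n)"
    and b: "(3 * real n + real (m + 3)) * b = real (m + 3) * real ((3 * n + (m + 3)) choose n)"
  shows "(3 * real (Suc n) + real (Suc m)) * (a + b) =
    real (Suc m) * real ((3 * Suc n + Suc m) choose Suc n)"
proof -
  define N where "N = 3 * Suc n + m"
  define P where "P = real (N choose Suc n)"
  define Q where "Q = real (N choose n)"
  have N: "real N = 3 * real n + 3 + real m"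
    by (simp add: N_def)
  \<comment> \<open>Both sides equal \<open>N * ((N - 1) choose n)\<close>.\<close>
  have "Suc n * (N choose Suc n) = (N - n) * (N choose n)"
    by (metis binomial_absorb_comp binomial_absorption)
  then have "real (Suc n) * P = real (N - n) * Q"
    unfolding P_def Q_def by (metis of_nat_mult)
  moreover have "real (N - n) = 2 * real n + 3 + real m"
    by (simp add: N_def)
  ultimately have absorb: "(real n + 1) * P = (2 * real n + 3 + real m) * Q"
    by (simp add: algebra_simps)
  have pascal: "real ((3 * Suc n + Suc m) choose Suc n) = P + Q"
  proof -
    have "3 * Suc n + Suc m = Suc N"
      by (simp add: N_def)
    then show ?thesis
      by (simp only: P_def Q_def binomial_Suc_Suc of_nat_add add.commute)
  qed
  have "real N * a = real m * P"
    using a by (simp only: P_def N_def of_nat_add of_nat_mult of_nat_numeral)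
  moreover have "real N * b = (real m + 3) * Q"
  proof -
    have e1: "3 * n + (m + 3) = N"
      by (simp add: N_def)
    have e2: "3 * real n + real (m + 3) = real N"
      by (simp add: N)
    show ?thesis
      using b[unfolded e1 e2] by (simp add: Q_def)
  qed
  ultimately have "real N * ((real N + 1) * (a + b)) = (real N + 1) * (real m * P + (real m + 3) * Q)"
    by algebra
  \<comment> \<open>The two sides differ by 3 times the difference of the two sides of
    \<open>absorb\<close>.\<close>
  also have "\<dots> = real N * ((real m + 1) * (P + Q))"
    using absorb unfolding N by algebra
  finally have "(real N + 1) * (a + b) = (real m + 1) * (P + Q)"
    using N by (simp del: of_nat_Suc)
  then show ?thesis
    unfolding pascal by (simp add: N algebra_simps)
qed

text \<open>The denominator is cleared, which also covers \<open>m = n = 0\<close>: there the count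
  is 1, but the quotient \<open>m / (3 * n + m)\<close> would be 0/0.\<close>

lemma card_forest_tuples:
  "(3 * real n + real m) * real (card (forest_tuples m n)) =
     real m * real ((3 * n + m) choose n)"
proof (induction n arbitrary: m)
  case 0
  show ?case
    by (simp add: card_forest_tuples_0_right)
next
  case (Suc n)
  \<comment> \<open>The inner induction rebinds \<open>Suc.IH\<close>; the outer hypothesis is still
    needed, at length \<open>m + 3\<close>.\<close>
  note outer = Suc.IH
  show ?case
  proof (induction m)
    case 0
    show ?case
      by (simp add: forest_tuples_0)
  next
    case (Suc m)
    show ?case
      using forest_recurrence_step[OF Suc.IH outer]
      by (simp only: card_forest_tuples_Suc_Suc of_nat_add)
  qed
qed

lemma trees_bij_betw_forest_pairs:
  "bij_betw (\<lambda>t. [left_deps t, right_deps t]) {t. num_nodes t = Suc n} (forest_tuples 2 n)"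
proof (rule bij_betw_byWitness[where f' = "\<lambda>fs. Node (fs ! 0) (fs ! 1)"])
  show "(\<lambda>t. [left_deps t, right_deps t]) ` {t. num_nodes t = Suc n} \<subseteq> forest_tuples 2 n"
  proof (rule image_subsetI)
    fix t assume "t \<in> {t. num_nodes t = Suc n}"
    then show "[left_deps t, right_deps t] \<in> forest_tuples 2 n"
      by (cases t) (simp add: forest_tuples_def num_nodes_Node del: num_nodes.simps)
  qed
qed (auto simp: forest_tuples_def length_Suc_conv numeral_2_eq_2 num_nodes_Node
    simp del: num_nodes.simps)

theorem mainTheorem2:
  fixes n :: nat
  assumes "n \<ge> 1"
  shows "finite {t :: deptree. num_nodes t = n} \<and>
    real (card {t :: deptree. num_nodes t = n}) = 1 / real n * real ((3 * n - 2) choose (n - 1))"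
proof -
  obtain k where n: "n = Suc k"
    using assms by (cases n) auto
  define C where "C = real (card (forest_tuples 2 k))"
  have fin: "finite {t. num_nodes t = n}"
    using bij_betw_finite[OF trees_bij_betw_forest_pairs] finite_forest_tuples n by blast
  have card: "real (card {t. num_nodes t = n}) = C"
    using bij_betw_same_card[OF trees_bij_betw_forest_pairs] n by (simp add: C_def)
  have "(3 * real k + 2) * C = 2 * real ((3 * k + 2) choose k)"
    using card_forest_tuples[of k 2] by (simp add: C_def)
  \<comment> \<open>Absorption lowers the upper index to \<open>3 * k + 1\<close>, which is
    \<open>3 * n - 2\<close>; the factor \<open>3 * k + 2\<close> then cancels.\<close>
  moreover have "(2 * k + 2) * ((3 * k + 2) choose k) = (3 * k + 2) * ((3 * k + 1) choose k)"
    using binomial_absorb_comp[of "3 * k + 2" k] by simp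
  then have "(2 * real k + 2) * real ((3 * k + 2) choose k)
      = (3 * real k + 2) * real ((3 * k + 1) choose k)"
    by (metis (mono_tags, lifting) of_nat_add of_nat_mult of_nat_numeral)
  ultimately have "(3 * real k + 2) * ((real k + 1) * C) = (3 * real k + 2) * real ((3 * k + 1) choose k)"
    by algebra
  moreover have "3 * real k + 2 \<noteq> 0"
    by linarith
  ultimately have "(real k + 1) * C = real ((3 * k + 1) choose k)"
    by (metis mult_left_cancel)
  then have "C = 1 / real n * real ((3 * n - 2) choose (n - 1))"
    by (simp add: n field_simps)
  with fin card show ?thesis
    by simp
qed

end
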